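(* Let $DN$ be a dendriform-Nijenhuis algebra. Then its vertical structure $DN_v:=(DN,\triangleleft,\triangleright,\bar\bullet)$ is an $NS$-algebra (with $\triangleleft,\triangleright,\bar\bullet$ in the roles of $\prec,\succ,\bullet$), and its horizontal structure $DN_h:=(DN,\wedge,\vee,\tilde\star)$ is a dendriform trialgebra (with $\wedge,\vee,\tilde\star$ in the roles of $\prec,\succ,\circ$).
   Context: Throughout, $k$ is a field of characteristic zero. A dendriform-Nijenhuis algebra is a $k$-vector space $D$ with nine bilinear operations $\nearrow,\searrow,\swarrow,\nwarrow,\uparrow,\downarrow,\tilde\prec,\tilde\succ,\tilde\bullet:D^{\otimes 2}\to D$ satisfying the 28 relations below, where sums of operations are pointwise and $\triangleleft:=\nwarrow+\swarrow+\tilde\prec$, $\triangleright:=\nearrow+\searrow+\tilde\succ$, $\bar\bullet:=\uparrow+\downarrow+\tilde\bullet$, $\wedge:=\nwarrow+\nearrow+\uparrow$, $\vee:=\searrow+\swarrow+\downarrow$, $\tilde\star:=\tilde\prec+\tilde\succ+\tilde\bullet$, and $\bar\star$ is the sum of all nine operations. For all $x,y,z$: (1) $(x\nwarrow y)\nwarrow z=x\nwarrow(y\bar\star z)$; $(x\nearrow y)\nwarrow z=x\nearrow(y\triangleleft z)$; $(x\wedge y)\nearrow z=x\nearrow(y\triangleright z)$; (2) $(x\swarrow y)\nwarrow z=x\swarrow(y\wedge z)$; $(x\searrow y)\nwarrow z=x\searrow(y\nwarrow z)$; $(x\vee y)\nearrow z=x\searrow(y\nearrow z)$; (3) $(x\triangleleft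 y)\swarrow z=x\swarrow(y\vee z)$; $(x\triangleright y)\swarrow z=x\searrow(y\swarrow z)$; $(x\bar\star y)\searrow z=x\searrow(y\searrow z)$; (4) $(x\swarrow y)\tilde\prec z=x\swarrow(y\tilde\star z)$; $(x\searrow y)\tilde\prec z=x\searrow(y\tilde\prec z)$; $(x\vee y)\tilde\succ z=x\searrow(y\tilde\succ z)$; (5) $(x\nwarrow y)\tilde\prec z=x\tilde\prec(y\vee z)$; $(x\nearrow y)\tilde\prec z=x\tilde\succ(y\swarrow z)$; $(x\wedge y)\tilde\succ z=x\tilde\succ(y\searrow z)$; (6) $(x\tilde\prec y)\nwarrow z=x\tilde\prec(y\wedge z)$; $(x\tilde\succ y)\nwarrow z=x\tilde\succ(y\nwarrow z)$; $(x\tilde\star y)\nearrow z=x\tilde\succ(y\nearrow z)$; (7) $(x\tilde\prec y)\tilde\prec z=x\tilde\prec(y\tilde\star z)$; $(x\tilde\succ y)\tilde\prec z=x\tilde\succ(y\tilde\prec z)$; $(x\tilde\star y)\tilde\succ z=x\tilde\succ(y\tilde\succ z)$; (8) $(x\wedge y)\uparrow z+(x\uparrow y)\nwarrow z=x\nearrow(y\bar\bullet z)+x\uparrow(y\bar\star z)$; (9) $(x\vee y)\uparrow z+(x\downarrow y)\nwarrow z=x\searrow(y\uparrow z)+x\downarrow(y\wedge z)$; (10) $(x\bar\star y)\downarrow z+(x\bar\bullet y)\swarrow z=x\searrow(y\downarrow z)+x\downarrow(y\vee z)$; (11) $(x\vee y)\tilde\bullet z+(x\downarrow y)\tilde\prec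 z=x\searrow(y\tilde\bullet z)+x\downarrow(y\tilde\star z)$; (12) $(x\wedge y)\tilde\bullet z+(x\uparrow y)\tilde\prec z=x\tilde\succ(y\downarrow z)+x\tilde\bullet(y\vee z)$; (13) $(x\tilde\star y)\uparrow z+(x\tilde\bullet y)\nwarrow z=x\tilde\succ(y\uparrow z)+x\tilde\bullet(y\wedge z)$; (14) $(x\tilde\star y)\tilde\bullet z+(x\tilde\bullet y)\tilde\prec z=x\tilde\succ(y\tilde\bullet z)+x\tilde\bullet(y\tilde\star z)$. An $NS$-algebra is a $k$-vector space with three bilinear operations $\prec,\succ,\bullet$ such that, with $\star:=\prec+\succ+\bullet$, for all $x,y,z$: $(x\prec y)\prec z=x\prec(y\star z)$; $(x\succ y)\prec z=x\succ(y\prec z)$; $(x\star y)\succ z=x\succ(y\succ z)$; $(x\star y)\bullet z+(x\bullet y)\prec z=x\succ(y\bullet z)+x\bullet(y\star z)$. A dendriform trialgebra is a $k$-vector space with three bilinear operations $\prec,\succ,\circ$ such that, with $\star:=\prec+\succ+\circ$, for all $x,y,z$: $(x\prec y)\prec z=x\prec(y\star z)$; $(x\succ y)\prec z=x\succ(y\prec z)$; $(x\star y)\succ z=x\succ(y\succ z)$; $(x\succ y)\circ z=x\succ(y\circ z)$; $(x\prec y)\circ z=x\circ(y\succ z)$; $(x\circ y)\prec z=x\circ(y\prec z)$; $(x\circ y)\circ z=x\circ(y\circ z)$. *)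

theory Defs
  imports Complex_Main "HOL-Library.Function_Algebras"
begin

text \<open>
  A sum of operations is pointwise: it is the \<open>+\<close> on functions from
  \<^theory>\<open>HOL-Library.Function_Algebras\<close>. The operations introduced by \<open>defines\<close> are
  expanded in the locale predicates and hence are not arguments of them.
\<close>

definition bilinear_op :: "('k::field \<Rightarrow> 'a::ab_group_add \<Rightarrow> 'a) \<Rightarrow> ('a \<Rightarrow> 'a \<Rightarrow> 'a) \<Rightarrow> bool"
  where "bilinear_op s f \<longleftrightarrow>
    (\<forall>x. Vector_Spaces.linear s s (\<lambda>y. f x y)) \<and> (\<forall>y. Vector_Spaces.linear s s (\<lambda>x. f x y))"

locale NS_algebra = vector_space scale
  for scale :: "'k::field_char_0 \<Rightarrow> 'a::ab_group_add \<Rightarrow> 'a" +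
  fixes prec :: "'a \<Rightarrow> 'a \<Rightarrow> 'a"  (infixl "\<prec>" 70)
    and succ :: "'a \<Rightarrow> 'a \<Rightarrow> 'a"  (infixl "\<succ>" 70)
    and bullet :: "'a \<Rightarrow> 'a \<Rightarrow> 'a"  (infixl "\<bullet>" 70)
    and star :: "'a \<Rightarrow> 'a \<Rightarrow> 'a"  (infixl "\<star>" 70)
  defines "star \<equiv> prec + succ + bullet"
  assumes bilinear:
      "bilinear_op scale prec"
      "bilinear_op scale succ"
      "bilinear_op scale bullet"
    and NS1: "(x \<prec> y) \<prec> z = x \<prec> (y \<star> z)"
    and NS2: "(x \<succ> y) \<prec> z = x \<succ> (y \<prec> z)"
    and NS3: "(x \<star> y) \<succ> z = x \<succ> (y \<succ> z)"
    and NS4: "(x \<star> y) \<bullet> z + (x \<bullet> y) \<prec> z = x \<succ> (y \<bullet> z) + x \<bullet> (y \<star> z)"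

locale dendriform_trialgebra = vector_space scale
  for scale :: "'k::field_char_0 \<Rightarrow> 'a::ab_group_add \<Rightarrow> 'a" +
  fixes prec :: "'a \<Rightarrow> 'a \<Rightarrow> 'a"  (infixl "\<prec>" 70)
    and succ :: "'a \<Rightarrow> 'a \<Rightarrow> 'a"  (infixl "\<succ>" 70)
    and circ :: "'a \<Rightarrow> 'a \<Rightarrow> 'a"  (infixl "\<odot>" 70)
    and star :: "'a \<Rightarrow> 'a \<Rightarrow> 'a"  (infixl "\<star>" 70)
  defines "star \<equiv> prec + succ + circ"
  assumes bilinear:
      "bilinear_op scale prec"
      "bilinear_op scale succ"
      "bilinear_op scale circ"
    and DT1: "(x \<prec> y) \<prec> z = x \<prec> (y \<star> z)"
    and DT2: "(x \<succ> y) \<prec> z = x \<succ> (y \<prec> z)"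
    and DT3: "(x \<star> y) \<succ> z = x \<succ> (y \<succ> z)"
    and DT4: "(x \<succ> y) \<odot> z = x \<succ> (y \<odot> z)"
    and DT5: "(x \<prec> y) \<odot> z = x \<odot> (y \<succ> z)"
    and DT6: "(x \<odot> y) \<prec> z = x \<odot> (y \<prec> z)"
    and DT7: "(x \<odot> y) \<odot> z = x \<odot> (y \<odot> z)"

text \<open>
  A subscript \<open>t\<close> stands for a tilde, a subscript \<open>b\<close> for a bar; the bold connectives
  are the operations wedge and vee.
\<close>

locale dendriform_nijenhuis_algebra = vector_space scale
  for scale :: "'k::field_char_0 \<Rightarrow> 'a::ab_group_add \<Rightarrow> 'a" +
  fixes ne :: "'a \<Rightarrow> 'a \<Rightarrow> 'a"  (infixl "\<nearrow>" 70)
    and se :: "'a \<Rightarrow> 'a \<Rightarrow> 'a"  (infixl "\<searrow>" 70)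
    and sw :: "'a \<Rightarrow> 'a \<Rightarrow> 'a"  (infixl "\<swarrow>" 70)
    and nw :: "'a \<Rightarrow> 'a \<Rightarrow> 'a"  (infixl "\<nwarrow>" 70)
    and up :: "'a \<Rightarrow> 'a \<Rightarrow> 'a"  (infixl "\<up>" 70)
    and down :: "'a \<Rightarrow> 'a \<Rightarrow> 'a"  (infixl "\<down>" 70)
    and tprec :: "'a \<Rightarrow> 'a \<Rightarrow> 'a"  (infixl "\<prec>\<^sub>t" 70)
    and tsucc :: "'a \<Rightarrow> 'a \<Rightarrow> 'a"  (infixl "\<succ>\<^sub>t" 70)
    and tbullet :: "'a \<Rightarrow> 'a \<Rightarrow> 'a"  (infixl "\<bullet>\<^sub>t" 70)
    and left :: "'a \<Rightarrow> 'a \<Rightarrow> 'a"  (infixl "\<triangleleft>" 70)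
    and right :: "'a \<Rightarrow> 'a \<Rightarrow> 'a"  (infixl "\<triangleright>" 70)
    and bbullet :: "'a \<Rightarrow> 'a \<Rightarrow> 'a"  (infixl "\<bullet>\<^sub>b" 70)
    and wedge :: "'a \<Rightarrow> 'a \<Rightarrow> 'a"  (infixl "\<^bold>\<and>" 70)
    and vee :: "'a \<Rightarrow> 'a \<Rightarrow> 'a"  (infixl "\<^bold>\<or>" 70)
    and tstar :: "'a \<Rightarrow> 'a \<Rightarrow> 'a"  (infixl "\<star>\<^sub>t" 70)
    and bstar :: "'a \<Rightarrow> 'a \<Rightarrow> 'a"  (infixl "\<star>\<^sub>b" 70)
  defines "left \<equiv> nw + sw + tprec"
      and "right \<equiv> ne + se + tsucc"
      and "bbullet \<equiv> up + down + tbullet"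
      and "wedge \<equiv> nw + ne + up"
      and "vee \<equiv> se + sw + down"
      and "tstar \<equiv> tprec + tsucc + tbullet"
      and "bstar \<equiv> ne + se + sw + nw + up + down + tprec + tsucc + tbullet"
  assumes bilinear:
      "bilinear_op scale ne"
      "bilinear_op scale se"
      "bilinear_op scale sw"
      "bilinear_op scale nw"
      "bilinear_op scale up"
      "bilinear_op scale down"
      "bilinear_op scale tprec"
      "bilinear_op scale tsucc"
      "bilinear_op scale tbullet"
    and DN1:
      "(x \<nwarrow> y) \<nwarrow> z = x \<nwarrow> (y \<star>\<^sub>b z)"
      "(x \<nearrow> y) \<nwarrow> z = x \<nearrow> (y \<triangleleft> z)"
      "(x \<^bold>\<and> y) \<nearrow> z = x \<nearrow> (y \<triangleright> z)"
    and DN2: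
      "(x \<swarrow> y) \<nwarrow> z = x \<swarrow> (y \<^bold>\<and> z)"
      "(x \<searrow> y) \<nwarrow> z = x \<searrow> (y \<nwarrow> z)"
      "(x \<^bold>\<or> y) \<nearrow> z = x \<searrow> (y \<nearrow> z)"
    and DN3:
      "(x \<triangleleft> y) \<swarrow> z = x \<swarrow> (y \<^bold>\<or> z)"
      "(x \<triangleright> y) \<swarrow> z = x \<searrow> (y \<swarrow> z)"
      "(x \<star>\<^sub>b y) \<searrow> z = x \<searrow> (y \<searrow> z)"
    and DN4:
      "(x \<swarrow> y) \<prec>\<^sub>t z = x \<swarrow> (y \<star>\<^sub>t z)"
      "(x \<searrow> y) \<prec>\<^sub>t z = x \<searrow> (y \<prec>\<^sub>t z)"
      "(x \<^bold>\<or> y) \<succ>\<^sub>t z = x \<searrow> (y \<succ>\<^sub>t z)"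
    and DN5:
      "(x \<nwarrow> y) \<prec>\<^sub>t z = x \<prec>\<^sub>t (y \<^bold>\<or> z)"
      "(x \<nearrow> y) \<prec>\<^sub>t z = x \<succ>\<^sub>t (y \<swarrow> z)"
      "(x \<^bold>\<and> y) \<succ>\<^sub>t z = x \<succ>\<^sub>t (y \<searrow> z)"
    and DN6:
      "(x \<prec>\<^sub>t y) \<nwarrow> z = x \<prec>\<^sub>t (y \<^bold>\<and> z)"
      "(x \<succ>\<^sub>t y) \<nwarrow> z = x \<succ>\<^sub>t (y \<nwarrow> z)"
      "(x \<star>\<^sub>t y) \<nearrow> z = x \<succ>\<^sub>t (y \<nearrow> z)"
    and DN7:
      "(x \<prec>\<^sub>t y) \<prec>\<^sub>t z = x \<prec>\<^sub>t (y \<star>\<^sub>t z)"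
      "(x \<succ>\<^sub>t y) \<prec>\<^sub>t z = x \<succ>\<^sub>t (y \<prec>\<^sub>t z)"
      "(x \<star>\<^sub>t y) \<succ>\<^sub>t z = x \<succ>\<^sub>t (y \<succ>\<^sub>t z)"
    and DN8:
      "(x \<^bold>\<and> y) \<up> z + (x \<up> y) \<nwarrow> z = x \<nearrow> (y \<bullet>\<^sub>b z) + x \<up> (y \<star>\<^sub>b z)"
    and DN9:
      "(x \<^bold>\<or> y) \<up> z + (x \<down> y) \<nwarrow> z = x \<searrow> (y \<up> z) + x \<down> (y \<^bold>\<and> z)"
    and DN10:
      "(x \<star>\<^sub>b y) \<down> z + (x \<bullet>\<^sub>b y) \<swarrow> z = x \<searrow> (y \<down> z) + x \<down> (y \<^bold>\<or> z)"
    and DN11: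
      "(x \<^bold>\<or> y) \<bullet>\<^sub>t z + (x \<down> y) \<prec>\<^sub>t z = x \<searrow> (y \<bullet>\<^sub>t z) + x \<down> (y \<star>\<^sub>t z)"
    and DN12:
      "(x \<^bold>\<and> y) \<bullet>\<^sub>t z + (x \<up> y) \<prec>\<^sub>t z = x \<succ>\<^sub>t (y \<down> z) + x \<bullet>\<^sub>t (y \<^bold>\<or> z)"
    and DN13:
      "(x \<star>\<^sub>t y) \<up> z + (x \<bullet>\<^sub>t y) \<nwarrow> z = x \<succ>\<^sub>t (y \<up> z) + x \<bullet>\<^sub>t (y \<^bold>\<and> z)"
    and DN14:
      "(x \<star>\<^sub>t y) \<bullet>\<^sub>t z + (x \<bullet>\<^sub>t y) \<prec>\<^sub>t z = x \<succ>\<^sub>t (y \<bullet>\<^sub>t z) + x \<bullet>\<^sub>t (y \<star>\<^sub>t z)"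

end

theory Submission
  imports Defs
begin

text \<open>
  Each axiom of the vertical and of the horizontal structure is, after expansion by
  bilinearity, the sum of some of the 28 relations. In the matrix of operations whose
  row sums are \<open>\<triangleleft>, \<triangleright>, \<bullet>\<^sub>b\<close> and whose column sums are \<open>\<^bold>\<and>, \<^bold>\<or>, \<star>\<^sub>t\<close>, the operation
  \<open>\<star>\<^sub>b\<close> is the sum of all entries, and thus plays the role of \<open>\<star>\<close> in both structures.
\<close>

lemma bilinear_op_add_left:
  assumes "bilinear_op s f"
  shows "f (x + y) z = f x z + f y z"
  using assms module_hom.add[of s s "\<lambda>x. f x z" x y]
  by (simp add: bilinear_op_def Vector_Spaces.linear_iff_module_hom)

lemma bilinear_op_add_right:
  assumes "bilinear_op s f"
  shows "f x (y + z) = f x y + f x z"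
  using assms module_hom.add[of s s "f x" y z]
  by (simp add: bilinear_op_def Vector_Spaces.linear_iff_module_hom)

lemma bilinear_op_plus:
  assumes f: "bilinear_op s f" and g: "bilinear_op s g"
  shows "bilinear_op s (f + g)"
proof -
  \<comment> \<open>\<open>Vector_Spaces.linear\<close> carries the vector space axioms with it, so
    bilinearity alone gives access to the closure of linear maps under pointwise sums.\<close>
  have "vector_space s"
    using f by (simp add: bilinear_op_def Vector_Spaces.linear_def)
  then interpret vector_space_pair s s
    by (simp add: vector_space_pair_def)
  show ?thesis
    using f g by (auto simp: bilinear_op_def intro: linear_compose_add)
qed

context dendriform_nijenhuis_algebra
begin

lemmas op_sums = left_def right_def bbullet_def wedge_def vee_def tstar_def bstar_def plus_fun_apply

text \<open>Brings both sides of an equation to a sorted sum of products in the nine basic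
  operations. A sum of relations and the axiom it yields then become the same equation.\<close>

lemmas expand = op_sums
  bilinear[THEN bilinear_op_add_left] bilinear[THEN bilinear_op_add_right]
  add.assoc add.commute add.left_commute

text \<open>The first relations of the seven groups \<open>DN1\<close> to \<open>DN7\<close> add up
  to \<open>NS1\<close>, the second ones to \<open>NS2\<close>, the third ones to
  \<open>NS3\<close>; \<open>DN8\<close> to \<open>DN14\<close> add up to
  \<open>NS4\<close>.\<close>

lemma NS_algebra_vertical: "NS_algebra scale left right bbullet"
proof
  show "bilinear_op scale left" "bilinear_op scale right" "bilinear_op scale bbullet"
    unfolding left_def right_def bbullet_def by (intro bilinear_op_plus bilinear)+
next
  fix x y z
  have "(x \<nwarrow> y) \<nwarrow> z + (x \<swarrow> y) \<nwarrow> z + (x \<triangleleft> y) \<swarrow> z + (x \<swarrow> y) \<prec>\<^sub>t z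
      + (x \<nwarrow> y) \<prec>\<^sub>t z + (x \<prec>\<^sub>t y) \<nwarrow> z + (x \<prec>\<^sub>t y) \<prec>\<^sub>t z
    = x \<nwarrow> (y \<star>\<^sub>b z) + x \<swarrow> (y \<^bold>\<and> z) + x \<swarrow> (y \<^bold>\<or> z) + x \<swarrow> (y \<star>\<^sub>t z)
      + x \<prec>\<^sub>t (y \<^bold>\<or> z) + x \<prec>\<^sub>t (y \<^bold>\<and> z) + x \<prec>\<^sub>t (y \<star>\<^sub>t z)"
    by (simp only: DN1 DN2 DN3 DN4 DN5 DN6 DN7)
  \<comment> \<open>On the right, \<open>sw\<close> and \<open>tprec\<close> each meet
    \<open>wedge\<close>, \<open>vee\<close> and \<open>tstar\<close> once, which together make
    \<open>bstar\<close>.\<close>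
  then show "(x \<triangleleft> y) \<triangleleft> z = x \<triangleleft> ((left + right + bbullet) y z)"
    by (simp only: expand)
  have "(x \<nearrow> y) \<nwarrow> z + (x \<searrow> y) \<nwarrow> z + (x \<triangleright> y) \<swarrow> z + (x \<searrow> y) \<prec>\<^sub>t z
      + (x \<nearrow> y) \<prec>\<^sub>t z + (x \<succ>\<^sub>t y) \<nwarrow> z + (x \<succ>\<^sub>t y) \<prec>\<^sub>t z
    = x \<nearrow> (y \<triangleleft> z) + x \<searrow> (y \<nwarrow> z) + x \<searrow> (y \<swarrow> z) + x \<searrow> (y \<prec>\<^sub>t z)
      + x \<succ>\<^sub>t (y \<swarrow> z) + x \<succ>\<^sub>t (y \<nwarrow> z) + x \<succ>\<^sub>t (y \<prec>\<^sub>t z)"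
    by (simp only: DN1 DN2 DN3 DN4 DN5 DN6 DN7)
  then show "(x \<triangleright> y) \<triangleleft> z = x \<triangleright> (y \<triangleleft> z)"
    by (simp only: expand)
  have "(x \<^bold>\<and> y) \<nearrow> z + (x \<^bold>\<or> y) \<nearrow> z + (x \<star>\<^sub>b y) \<searrow> z + (x \<^bold>\<or> y) \<succ>\<^sub>t z
      + (x \<^bold>\<and> y) \<succ>\<^sub>t z + (x \<star>\<^sub>t y) \<nearrow> z + (x \<star>\<^sub>t y) \<succ>\<^sub>t z
    = x \<nearrow> (y \<triangleright> z) + x \<searrow> (y \<nearrow> z) + x \<searrow> (y \<searrow> z) + x \<searrow> (y \<succ>\<^sub>t z)
      + x \<succ>\<^sub>t (y \<searrow> z) + x \<succ>\<^sub>t (y \<nearrow> z) + x \<succ>\<^sub>t (y \<succ>\<^sub>t z)"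
    by (simp only: DN1 DN2 DN3 DN4 DN5 DN6 DN7)
  then show "((left + right + bbullet) x y) \<triangleright> z = x \<triangleright> (y \<triangleright> z)"
    by (simp only: expand)
  have "((x \<^bold>\<and> y) \<up> z + (x \<up> y) \<nwarrow> z) + ((x \<^bold>\<or> y) \<up> z + (x \<down> y) \<nwarrow> z)
      + ((x \<star>\<^sub>b y) \<down> z + (x \<bullet>\<^sub>b y) \<swarrow> z) + ((x \<^bold>\<or> y) \<bullet>\<^sub>t z + (x \<down> y) \<prec>\<^sub>t z)
      + ((x \<^bold>\<and> y) \<bullet>\<^sub>t z + (x \<up> y) \<prec>\<^sub>t z) + ((x \<star>\<^sub>t y) \<up> z + (x \<bullet>\<^sub>t y) \<nwarrow> z)
      + ((x \<star>\<^sub>t y) \<bullet>\<^sub>t z + (x \<bullet>\<^sub>t y) \<prec>\<^sub>t z)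
    = (x \<nearrow> (y \<bullet>\<^sub>b z) + x \<up> (y \<star>\<^sub>b z)) + (x \<searrow> (y \<up> z) + x \<down> (y \<^bold>\<and> z))
      + (x \<searrow> (y \<down> z) + x \<down> (y \<^bold>\<or> z)) + (x \<searrow> (y \<bullet>\<^sub>t z) + x \<down> (y \<star>\<^sub>t z))
      + (x \<succ>\<^sub>t (y \<down> z) + x \<bullet>\<^sub>t (y \<^bold>\<or> z)) + (x \<succ>\<^sub>t (y \<up> z) + x \<bullet>\<^sub>t (y \<^bold>\<and> z))
      + (x \<succ>\<^sub>t (y \<bullet>\<^sub>t z) + x \<bullet>\<^sub>t (y \<star>\<^sub>t z))"
    by (simp only: DN8 DN9 DN10 DN11 DN12 DN13 DN14)
  \<comment> \<open>On the left, \<open>up\<close> and \<open>tbullet\<close> collect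
    \<open>bstar\<close> from the three column sums, while \<open>nw\<close> and
    \<open>tprec\<close> collect \<open>bbullet\<close> from \<open>up\<close>, \<open>down\<close>
    and \<open>tbullet\<close>; \<open>DN10\<close> supplies the \<open>down\<close> and
    \<open>sw\<close> terms already summed.\<close>
  then show "((left + right + bbullet) x y) \<bullet>\<^sub>b z + (x \<bullet>\<^sub>b y) \<triangleleft> z
    = x \<triangleright> (y \<bullet>\<^sub>b z) + x \<bullet>\<^sub>b ((left + right + bbullet) y z)"
    by (simp only: expand)
qed

text \<open>Here the relations are added within a group: for i from 1 to 7, the three relations of
  the i-th group and the single relation numbered i + 7 add up to the i-th trialgebra axiom.\<close>

lemma dendriform_trialgebra_horizontal: "dendriform_trialgebra scale wedge vee tstar"
proof
  show "bilinear_op scale wedge" "bilinear_op scale vee" "bilinear_op scale tstar"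
    unfolding wedge_def vee_def tstar_def by (intro bilinear_op_plus bilinear)+
next
  fix x y z
  have "(x \<nwarrow> y) \<nwarrow> z + (x \<nearrow> y) \<nwarrow> z + (x \<^bold>\<and> y) \<nearrow> z + ((x \<^bold>\<and> y) \<up> z + (x \<up> y) \<nwarrow> z)
    = x \<nwarrow> (y \<star>\<^sub>b z) + x \<nearrow> (y \<triangleleft> z) + x \<nearrow> (y \<triangleright> z) + (x \<nearrow> (y \<bullet>\<^sub>b z) + x \<up> (y \<star>\<^sub>b z))"
    by (simp only: DN1 DN8)
  \<comment> \<open>Now \<open>bstar\<close> arises from the row sums: \<open>ne\<close> is applied
    to \<open>left\<close>, \<open>right\<close> and \<open>bbullet\<close> of \<open>y\<close> and
    \<open>z\<close>.\<close>
  then show "(x \<^bold>\<and> y) \<^bold>\<and> z = x \<^bold>\<and> ((wedge + vee + tstar) y z)"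
    by (simp only: expand)
  have "(x \<swarrow> y) \<nwarrow> z + (x \<searrow> y) \<nwarrow> z + (x \<^bold>\<or> y) \<nearrow> z + ((x \<^bold>\<or> y) \<up> z + (x \<down> y) \<nwarrow> z)
    = x \<swarrow> (y \<^bold>\<and> z) + x \<searrow> (y \<nwarrow> z) + x \<searrow> (y \<nearrow> z) + (x \<searrow> (y \<up> z) + x \<down> (y \<^bold>\<and> z))"
    by (simp only: DN2 DN9)
  then show "(x \<^bold>\<or> y) \<^bold>\<and> z = x \<^bold>\<or> (y \<^bold>\<and> z)"
    by (simp only: expand)
  have "(x \<triangleleft> y) \<swarrow> z + (x \<triangleright> y) \<swarrow> z + (x \<star>\<^sub>b y) \<searrow> z + ((x \<star>\<^sub>b y) \<down> z + (x \<bullet>\<^sub>b y) \<swarrow> z)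
    = x \<swarrow> (y \<^bold>\<or> z) + x \<searrow> (y \<swarrow> z) + x \<searrow> (y \<searrow> z) + (x \<searrow> (y \<down> z) + x \<down> (y \<^bold>\<or> z))"
    by (simp only: DN3 DN10)
  then show "((wedge + vee + tstar) x y) \<^bold>\<or> z = x \<^bold>\<or> (y \<^bold>\<or> z)"
    by (simp only: expand)
  have "(x \<swarrow> y) \<prec>\<^sub>t z + (x \<searrow> y) \<prec>\<^sub>t z + (x \<^bold>\<or> y) \<succ>\<^sub>t z + ((x \<^bold>\<or> y) \<bullet>\<^sub>t z + (x \<down> y) \<prec>\<^sub>t z)
    = x \<swarrow> (y \<star>\<^sub>t z) + x \<searrow> (y \<prec>\<^sub>t z) + x \<searrow> (y \<succ>\<^sub>t z) + (x \<searrow> (y \<bullet>\<^sub>t z) + x \<down> (y \<star>\<^sub>t z))"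
    by (simp only: DN4 DN11)
  then show "(x \<^bold>\<or> y) \<star>\<^sub>t z = x \<^bold>\<or> (y \<star>\<^sub>t z)"
    by (simp only: expand)
  have "(x \<nwarrow> y) \<prec>\<^sub>t z + (x \<nearrow> y) \<prec>\<^sub>t z + (x \<^bold>\<and> y) \<succ>\<^sub>t z + ((x \<^bold>\<and> y) \<bullet>\<^sub>t z + (x \<up> y) \<prec>\<^sub>t z)
    = x \<prec>\<^sub>t (y \<^bold>\<or> z) + x \<succ>\<^sub>t (y \<swarrow> z) + x \<succ>\<^sub>t (y \<searrow> z) + (x \<succ>\<^sub>t (y \<down> z) + x \<bullet>\<^sub>t (y \<^bold>\<or> z))"
    by (simp only: DN5 DN12)
  \<comment> \<open>The terms with \<open>sw\<close>, \<open>se\<close> and \<open>down\<close>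
    inside \<open>tsucc\<close> make up \<open>vee\<close>, the form that \<open>tprec\<close> and
    \<open>tbullet\<close> already have.\<close>
  then show "(x \<^bold>\<and> y) \<star>\<^sub>t z = x \<star>\<^sub>t (y \<^bold>\<or> z)"
    by (simp only: expand)
  have "(x \<prec>\<^sub>t y) \<nwarrow> z + (x \<succ>\<^sub>t y) \<nwarrow> z + (x \<star>\<^sub>t y) \<nearrow> z + ((x \<star>\<^sub>t y) \<up> z + (x \<bullet>\<^sub>t y) \<nwarrow> z)
    = x \<prec>\<^sub>t (y \<^bold>\<and> z) + x \<succ>\<^sub>t (y \<nwarrow> z) + x \<succ>\<^sub>t (y \<nearrow> z) + (x \<succ>\<^sub>t (y \<up> z) + x \<bullet>\<^sub>t (y \<^bold>\<and> z))"
    by (simp only: DN6 DN13)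
  then show "(x \<star>\<^sub>t y) \<^bold>\<and> z = x \<star>\<^sub>t (y \<^bold>\<and> z)"
    by (simp only: expand)
  have "(x \<prec>\<^sub>t y) \<prec>\<^sub>t z + (x \<succ>\<^sub>t y) \<prec>\<^sub>t z + (x \<star>\<^sub>t y) \<succ>\<^sub>t z + ((x \<star>\<^sub>t y) \<bullet>\<^sub>t z + (x \<bullet>\<^sub>t y) \<prec>\<^sub>t z)
    = x \<prec>\<^sub>t (y \<star>\<^sub>t z) + x \<succ>\<^sub>t (y \<prec>\<^sub>t z) + x \<succ>\<^sub>t (y \<succ>\<^sub>t z) + (x \<succ>\<^sub>t (y \<bullet>\<^sub>t z) + x \<bullet>\<^sub>t (y \<star>\<^sub>t z))"
    by (simp only: DN7 DN14)
  then show "(x \<star>\<^sub>t y) \<star>\<^sub>t z = x \<star>\<^sub>t (y \<star>\<^sub>t z)"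
    by (simp only: expand)
qed

end

theorem theorem5p2:
  fixes scale :: "'k::field_char_0 \<Rightarrow> 'a::ab_group_add \<Rightarrow> 'a"
    and ne se sw nw up down tprec tsucc tbullet :: "'a \<Rightarrow> 'a \<Rightarrow> 'a"
  assumes "dendriform_nijenhuis_algebra scale ne se sw nw up down tprec tsucc tbullet"
  shows "NS_algebra scale (nw + sw + tprec) (ne + se + tsucc) (up + down + tbullet) \<and>
    dendriform_trialgebra scale (nw + ne + up) (se + sw + down) (tprec + tsucc + tbullet)"
  using assms
  \<comment> \<open>Outside the locale the operations given by \<open>defines\<close> are unfolded,
    so both facts speak of the explicit sums.\<close>
  by (intro conjI dendriform_nijenhuis_algebra.NS_algebra_vertical
      dendriform_nijenhuis_algebra.dendriform_trialgebra_horizontal)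

end
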